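(* Let $\mathcal{T}=(V,\mathsf{p})$ be a directed forest. Then the following conditions are equivalent: (a) every bounded hyponormal weighted shift on $\mathcal{T}$ is power hyponormal; (b) the square of any bounded hyponormal weighted shift on $\mathcal{T}$ is hyponormal; (c) the leafless support $\mathring{\mathcal{T}}$ of $\mathcal{T}$ is forkless; (d) every leafless directed forest thinner than $\mathcal{T}$ is forkless.
   Context: A directed forest is a pair $\mathcal{T}=(V,\mathsf{p})$ where $V$ is a nonempty set and $\mathsf{p}\colon V\to V$ satisfies: if $n\in\mathbb{N}$, $v\in V$ and $\mathsf{p}^n(v)=v$, then $\mathsf{p}(v)=v$. The roots are $\mathrm{root}(\mathcal{T})=\{v\in V:\mathsf{p}(v)=v\}$, and $V^\circ=V\setminus\mathrm{root}(\mathcal{T})$. The children of $v$ are $\mathrm{Chi}(v)=\{u\in V:\mathsf{p}(u)=v\neq u\}$ and $\deg(v)$ is the cardinality of $\mathrm{Chi}(v)$. A leaf is an element of $V\setminus\mathsf{p}(V)$; $\mathcal{T}$ is leafless if $\mathsf{p}(V)=V$. $\mathcal{T}$ is forkless if $\deg(v)=1$ for every $v\in V^\circ$. For directed forests $\mathcal{T}_1=(V,\mathsf{p}_1)$, $\mathcal{T}_2=(V,\mathsf{p}_2)$ on the same vertex set, $\mathcal{T}_1$ is thinner than $\mathcal{T}_2$ if $\mathsf{p}_1(v)\in\{v,\mathsf{p}_2(v)\}$ for every $v\in V$. The leafless support $\mathring{\mathcal{T}}$ of $\mathcal{T}$ is the thickest (greatest with respect to "thinner than") leafless directed forest on $V$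 thinner than $\mathcal{T}$ (such a greatest element exists). A system of weights on $\mathcal{T}$ is a family ${\boldsymbol\lambda}=\{\lambda_v\}_{v\in V}\subseteq\mathbb{C}$ with $\lambda_\omega=0$ for all roots $\omega$; the weighted shift $S_{\boldsymbol\lambda}$ on $\mathcal{T}$ is the operator in $\ell^2(V)$ with domain $\{f\in\ell^2(V):\Gamma_{\boldsymbol\lambda}(f)\in\ell^2(V)\}$ and $S_{\boldsymbol\lambda}f=\Gamma_{\boldsymbol\lambda}(f)$, where $\Gamma_{\boldsymbol\lambda}(f)(v)=\lambda_v f(\mathsf{p}(v))$. A bounded operator $T$ on a Hilbert space is hyponormal if $T^*T-TT^*\geq 0$, and power hyponormal if $T^n$ is hyponormal for every $n\geq1$. *)

theory Defs
  imports "HOL-Analysis.Analysis"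
begin

text \<open>Directed forests. The vertex set V is the (nonempty) universe of the type 'v,
  and p is the parent map.  The exponent n ranges over positive integers.\<close>

definition directed_forest :: "('v \<Rightarrow> 'v) \<Rightarrow> bool" where
  "directed_forest p \<longleftrightarrow> (\<forall>n::nat. \<forall>v. n \<ge> 1 \<longrightarrow> (p ^^ n) v = v \<longrightarrow> p v = v)"

definition roots :: "('v \<Rightarrow> 'v) \<Rightarrow> 'v set" where
  "roots p = {v. p v = v}"

definition Chi :: "('v \<Rightarrow> 'v) \<Rightarrow> 'v \<Rightarrow> 'v set" where
  "Chi p v = {u. p u = v \<and> v \<noteq> u}"

text \<open>deg v = 1 means Chi v is a singleton (card of an infinite set is 0).\<close>
definition forkless :: "('v \<Rightarrow> 'v) \<Rightarrow> bool" where
  "forkless p \<longleftrightarrow> (\<forall>v. v \<notin> roots p \<longrightarrow> card (Chi p v) = 1)"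

definition leafless :: "('v \<Rightarrow> 'v) \<Rightarrow> bool" where
  "leafless p \<longleftrightarrow> range p = UNIV"

definition thinner :: "('v \<Rightarrow> 'v) \<Rightarrow> ('v \<Rightarrow> 'v) \<Rightarrow> bool" where
  "thinner p1 p2 \<longleftrightarrow> (\<forall>v. p1 v \<in> {v, p2 v})"

definition leafless_support :: "('v \<Rightarrow> 'v) \<Rightarrow> ('v \<Rightarrow> 'v)" where
  "leafless_support p = (THE q. directed_forest q \<and> leafless q \<and> thinner q p \<and>
       (\<forall>q'. directed_forest q' \<and> leafless q' \<and> thinner q' p \<longrightarrow> thinner q' q))"

definition ell2 :: "('v \<Rightarrow> complex) \<Rightarrow> bool" where
  "ell2 f \<longleftrightarrow> (\<lambda>v. (cmod (f v))\<^sup>2) summable_on UNIV"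

definition l2inner :: "('v \<Rightarrow> complex) \<Rightarrow> ('v \<Rightarrow> complex) \<Rightarrow> complex" where
  "l2inner f g = (\<Sum>\<^sub>\<infinity>v. f v * cnj (g v))"

definition l2norm :: "('v \<Rightarrow> complex) \<Rightarrow> real" where
  "l2norm f = sqrt (\<Sum>\<^sub>\<infinity>v. (cmod (f v))\<^sup>2)"

definition weights :: "('v \<Rightarrow> 'v) \<Rightarrow> ('v \<Rightarrow> complex) \<Rightarrow> bool" where
  "weights p lam \<longleftrightarrow> (\<forall>w \<in> roots p. lam w = 0)"

definition wshift :: "('v \<Rightarrow> 'v) \<Rightarrow> ('v \<Rightarrow> complex) \<Rightarrow> ('v \<Rightarrow> complex) \<Rightarrow> ('v \<Rightarrow> complex)" where
  "wshift p lam f = (\<lambda>v. lam v * f (p v))"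

text \<open>Bounded: the maximal domain is all of l2(V) and the operator is bounded there.\<close>
definition bounded_on_l2 :: "(('v \<Rightarrow> complex) \<Rightarrow> ('v \<Rightarrow> complex)) \<Rightarrow> bool" where
  "bounded_on_l2 T \<longleftrightarrow> (\<forall>f. ell2 f \<longrightarrow> ell2 (T f)) \<and>
      (\<exists>C. \<forall>f. ell2 f \<longrightarrow> l2norm (T f) \<le> C * l2norm f)"

definition is_adjoint :: "(('v \<Rightarrow> complex) \<Rightarrow> ('v \<Rightarrow> complex)) \<Rightarrow> (('v \<Rightarrow> complex) \<Rightarrow> ('v \<Rightarrow> complex)) \<Rightarrow> bool" where
  "is_adjoint T A \<longleftrightarrow> (\<forall>g. ell2 g \<longrightarrow> ell2 (A g)) \<and>
      (\<forall>f g. ell2 f \<longrightarrow> ell2 g \<longrightarrow> l2inner (T f) g = l2inner f (A g))"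

definition hyponormal :: "(('v \<Rightarrow> complex) \<Rightarrow> ('v \<Rightarrow> complex)) \<Rightarrow> bool" where
  "hyponormal T \<longleftrightarrow> bounded_on_l2 T \<and> (\<exists>A. is_adjoint T A \<and>
      (\<forall>f. ell2 f \<longrightarrow> Im (l2inner (\<lambda>v. A (T f) v - T (A f) v) f) = 0 \<and>
                      Re (l2inner (\<lambda>v. A (T f) v - T (A f) v) f) \<ge> 0))"

end

theory Submission
  imports Defs
begin

text \<open>If \<open>S\<close> is a hyponormal weighted shift, then testing \<open>\<parallel>S\<^sup>* f\<parallel> \<le> \<parallel>S f\<parallel>\<close> on unit vectors shows that
  every vertex with nonzero weight has a child with nonzero weight. Hence the support of the weights
  lies in the set of non-roots of the leafless support.

  If the leafless support is forkless, each vertex in the support of the weights therefore starts a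
  unique line of descendants, along which the moduli of the weights increase. With \<open>P\<close> the projection
  onto the support, \<open>\<parallel>S\<^sup>*\<^sup>n f\<parallel> = \<parallel>S\<^sup>* P S\<^sup>*\<^sup>n\<^sup>-\<^sup>1 f\<parallel> \<le> \<parallel>S P S\<^sup>*\<^sup>n\<^sup>-\<^sup>1 f\<parallel> \<le> \<parallel>S\<^sup>n f\<parallel>\<close>, the last
  step being a termwise comparison along these lines. Forks at roots of the leafless support do no harm, since these are
  removed by \<open>P\<close>.

  If, on the other hand, a non-root \<open>v\<close> of the leafless support has two children \<open>a\<close> and \<open>b\<close> there,
  put the weight 2 at \<open>v\<close>, the weights 2/3, 1, 1, \<dots> on a line of descendants starting at \<open>a\<close>, and the
  weights 2, 3, 3, \<dots> on one starting at \<open>b\<close>. The large weight at \<open>b\<close> makes \<open>\<parallel>S e\<^sub>v\<parallel>\<close> large enough to keep \<open>S\<close> hyponormal, but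
  \<open>\<parallel>S\<^sup>*\<^sup>2 e\<^sub>a\<parallel> = 4/3 > 1 = \<parallel>S\<^sup>2 e\<^sub>a\<parallel>\<close>.\<close>

section \<open>Square-summable functions and adjoints\<close>

lemma infsum_single:
  fixes f :: "'a \<Rightarrow> 'b::{comm_monoid_add, t2_space}"
  assumes "\<And>x. x \<noteq> u \<Longrightarrow> f x = 0"
  shows "infsum f UNIV = f u"
proof -
  have "infsum f UNIV = infsum f {u}"
    using assms by (intro infsum_cong_neutral) auto
  then show ?thesis by simp
qed

text \<open>Reindexed by \<open>\<phi>\<close>, the bounds on \<open>h\<close> add up to a subsum of
  the nonnegative family \<open>k\<close>. The change of index allows values at different vertices
  to be matched.\<close>

lemma summable_infsum_le_inj:
  fixes h :: "'a \<Rightarrow> real" and k :: "'b \<Rightarrow> real"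
  assumes k: "k summable_on UNIV" and k0: "\<And>y. 0 \<le> k y"
    and inj: "inj_on \<phi> B"
    and h0: "\<And>x. x \<in> B \<Longrightarrow> 0 \<le> h x" and le: "\<And>x. x \<in> B \<Longrightarrow> h x \<le> k (\<phi> x)"
  shows "h summable_on B" "infsum h B \<le> infsum k UNIV"
proof -
  have "k summable_on \<phi> ` B"
    using k summable_on_subset_banach by blast
  then have s: "(k \<circ> \<phi>) summable_on B"
    by (simp add: summable_on_reindex[OF inj])
  show hs: "h summable_on B"
    by (rule summable_on_comparison_test[OF s]) (auto intro: le h0)
  have "infsum h B \<le> infsum (k \<circ> \<phi>) B"
    by (rule infsum_mono[OF hs s]) (auto intro: le)
  also have "\<dots> = infsum k (\<phi> ` B)"
    by (simp add: infsum_reindex[OF inj])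
  also have "\<dots> \<le> infsum k UNIV"
    using k \<open>k summable_on \<phi> ` B\<close> k0 by (intro infsum_mono2) auto
  finally show "infsum h B \<le> infsum k UNIV" .
qed

lemma ell2_support:
  assumes "\<And>x. x \<notin> B \<Longrightarrow> f x = 0"
  shows "ell2 f \<longleftrightarrow> (\<lambda>v. (cmod (f v))\<^sup>2) summable_on B"
    and "(\<Sum>\<^sub>\<infinity>v. (cmod (f v))\<^sup>2) = (\<Sum>\<^sub>\<infinity>v\<in>B. (cmod (f v))\<^sup>2)"
  unfolding ell2_def
  by (rule summable_on_cong_neutral infsum_cong_neutral; use assms in auto)+

lemma l2norm_le_iff: "l2norm f \<le> l2norm g \<longleftrightarrow> (\<Sum>\<^sub>\<infinity>v. (cmod (f v))\<^sup>2) \<le> (\<Sum>\<^sub>\<infinity>v. (cmod (g v))\<^sup>2)"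
  by (simp add: l2norm_def)

text \<open>Each value of \<open>f\<close> is charged to a different value of \<open>g\<close>,
  hence the injectivity. With \<open>\<phi>\<close> the identity this covers cutting off to
  \<open>B\<close>; with \<open>\<phi> = p\<close> it bounds a shift.\<close>

lemma l2norm_le_inj:
  assumes g: "ell2 g" and inj: "inj_on \<phi> B"
    and le: "\<And>x. x \<in> B \<Longrightarrow> cmod (f x) \<le> cmod (g (\<phi> x))"
    and supp: "\<And>x. x \<notin> B \<Longrightarrow> f x = 0"
  shows "ell2 f" "l2norm f \<le> l2norm g"
proof -
  have *: "(\<lambda>v. (cmod (f v))\<^sup>2) summable_on B"
      "(\<Sum>\<^sub>\<infinity>v\<in>B. (cmod (f v))\<^sup>2) \<le> (\<Sum>\<^sub>\<infinity>v. (cmod (g v))\<^sup>2)"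
    using summable_infsum_le_inj[OF _ _ inj, of "\<lambda>v. (cmod (g v))\<^sup>2" "\<lambda>v. (cmod (f v))\<^sup>2"] g le
    by (auto simp: ell2_def intro: power_mono)
  then show "ell2 f" "l2norm f \<le> l2norm g"
    using ell2_support[of B f, OF supp] by (auto simp: l2norm_le_iff)
qed

lemma l2norm_nonneg: "0 \<le> l2norm f"
  by (simp add: l2norm_def infsum_nonneg)

lemma cmod_le_l2norm: "ell2 f \<Longrightarrow> cmod (f u) \<le> l2norm f"
proof -
  assume f: "ell2 f"
  have "(\<Sum>\<^sub>\<infinity>v\<in>{u}. (cmod (f v))\<^sup>2) \<le> (\<Sum>\<^sub>\<infinity>v. (cmod (f v))\<^sup>2)"
    using f by (intro infsum_mono2) (auto simp: ell2_def)
  then show ?thesis by (simp add: l2norm_def real_le_rsqrt)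
qed

lemma ell2_cmult: "ell2 f \<Longrightarrow> ell2 (\<lambda>v. c * f v)"
  unfolding ell2_def by (simp add: norm_mult power_mult_distrib summable_on_cmult_right)

lemma l2norm_cmult: "l2norm (\<lambda>v. c * f v) = cmod c * l2norm f"
  by (simp add: l2norm_def norm_mult power_mult_distrib infsum_cmult_right' real_sqrt_mult)

lemma cmod_add_square_le: "(cmod (a + b))\<^sup>2 \<le> 2 * (cmod a)\<^sup>2 + 2 * (cmod b)\<^sup>2"
proof -
  have "(cmod (a + b))\<^sup>2 \<le> (cmod a + cmod b)\<^sup>2"
    by (intro power_mono norm_triangle_ineq) auto
  also have "\<dots> \<le> 2 * (cmod a)\<^sup>2 + 2 * (cmod b)\<^sup>2"
    using sum_squares_bound[of "cmod a" "cmod b"] by (simp add: power2_sum)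
  finally show ?thesis .
qed

lemma ell2_add:
  assumes "ell2 f" "ell2 g"
  shows "ell2 (\<lambda>v. f v + g v)"
  unfolding ell2_def
proof (rule summable_on_comparison_test)
  show "(\<lambda>v. 2 * (cmod (f v))\<^sup>2 + 2 * (cmod (g v))\<^sup>2) summable_on UNIV"
    using assms unfolding ell2_def by (intro summable_on_add summable_on_cmult_right)
qed (auto simp: cmod_add_square_le)

lemma l2norm_add_square_le:
  assumes "ell2 f" "ell2 g"
  shows "(l2norm (\<lambda>v. f v + g v))\<^sup>2 \<le> 2 * (l2norm f)\<^sup>2 + 2 * (l2norm g)\<^sup>2"
proof -
  have s: "(\<lambda>v. 2 * (cmod (f v))\<^sup>2) summable_on UNIV" "(\<lambda>v. 2 * (cmod (g v))\<^sup>2) summable_on UNIV"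
    using assms unfolding ell2_def by (intro summable_on_cmult_right; simp)+
  have "(\<Sum>\<^sub>\<infinity>v. (cmod (f v + g v))\<^sup>2) \<le> (\<Sum>\<^sub>\<infinity>v. 2 * (cmod (f v))\<^sup>2 + 2 * (cmod (g v))\<^sup>2)"
    using ell2_add[OF assms] s unfolding ell2_def
    by (intro infsum_mono summable_on_add) (auto simp: cmod_add_square_le)
  also have "\<dots> = 2 * (\<Sum>\<^sub>\<infinity>v. (cmod (f v))\<^sup>2) + 2 * (\<Sum>\<^sub>\<infinity>v. (cmod (g v))\<^sup>2)"
    using infsum_add[OF s] by (simp add: infsum_cmult_right')
  finally show ?thesis by (simp add: l2norm_def infsum_nonneg)
qed

lemma l2inner_summable:
  assumes "ell2 f" "ell2 g"
  shows "(\<lambda>v. f v * cnj (g v)) summable_on UNIV"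
proof (rule abs_summable_summable, rule summable_on_comparison_test)
  show "(\<lambda>v. (cmod (f v))\<^sup>2 + (cmod (g v))\<^sup>2) summable_on UNIV"
    using assms unfolding ell2_def by (rule summable_on_add)
  show "norm (f v * cnj (g v)) \<le> (cmod (f v))\<^sup>2 + (cmod (g v))\<^sup>2" for v
    using sum_squares_bound[of "cmod (f v)" "cmod (g v)"]
      mult_nonneg_nonneg[of "cmod (f v)" "cmod (g v)"]
    by (simp add: norm_mult del: mult_nonneg_nonneg)
qed auto

lemma l2inner_add_left:
  assumes "ell2 f" "ell2 g" "ell2 h"
  shows "l2inner (\<lambda>v. f v + g v) h = l2inner f h + l2inner g h"
  unfolding l2inner_def
  using infsum_add[OF l2inner_summable[OF assms(1,3)] l2inner_summable[OF assms(2,3)]]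
  by (simp add: distrib_right)

lemma l2inner_cnj: "cnj (l2inner f g) = l2inner g f"
  unfolding l2inner_def infsum_cnj[symmetric] by (simp add: mult.commute)

lemma l2inner_add_right:
  assumes "ell2 f" "ell2 g" "ell2 h"
  shows "l2inner h (\<lambda>v. f v + g v) = l2inner h f + l2inner h g"
  using arg_cong[OF l2inner_add_left[OF assms], of cnj] by (simp add: l2inner_cnj)

lemma l2inner_diff_left:
  assumes "ell2 f" "ell2 g" "ell2 h"
  shows "l2inner (\<lambda>v. f v - g v) h = l2inner f h - l2inner g h"
proof -
  have "l2inner (\<lambda>v. - g v) h = - l2inner g h"
    by (simp add: l2inner_def infsum_uminus)
  then show ?thesis
    using l2inner_add_left[OF assms(1) ell2_cmult[OF assms(2), of "-1"] assms(3)] by simp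
qed

lemma l2inner_self:
  assumes "ell2 f"
  shows "l2inner f f = of_real ((l2norm f)\<^sup>2)"
proof -
  have "l2inner f f = (\<Sum>\<^sub>\<infinity>v. of_real ((cmod (f v))\<^sup>2))"
    unfolding l2inner_def by (intro infsum_cong) (simp only: complex_norm_square)
  also have "\<dots> = of_real (\<Sum>\<^sub>\<infinity>v. (cmod (f v))\<^sup>2)"
    using assms unfolding ell2_def by (intro infsumI has_sum_of_real has_sum_infsum)
  also have "(\<Sum>\<^sub>\<infinity>v. (cmod (f v))\<^sup>2) = (l2norm f)\<^sup>2"
    by (simp add: l2norm_def infsum_nonneg)
  finally show ?thesis .
qed

text \<open>Moving \<open>A\<close> across the inner product gives
  \<open><(A T - T A) f, f> = ||T f||^2 - ||A f||^2\<close>, a real number, so positivity becomes a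
  comparison of norms.\<close>

lemma hyponormal_iff:
  "hyponormal T \<longleftrightarrow>
     bounded_on_l2 T \<and> (\<exists>A. is_adjoint T A \<and> (\<forall>f. ell2 f \<longrightarrow> l2norm (A f) \<le> l2norm (T f)))"
proof -
  have "l2inner (\<lambda>v. A (T f) v - T (A f) v) f = of_real ((l2norm (T f))\<^sup>2 - (l2norm (A f))\<^sup>2)"
    if T: "bounded_on_l2 T" and A: "is_adjoint T A" and f: "ell2 f" for A f
  proof -
    have ell2: "ell2 (T f)" "ell2 (A f)" "ell2 (A (T f))" "ell2 (T (A f))"
      using T A f by (auto simp: bounded_on_l2_def is_adjoint_def)
    have "l2inner (A (T f)) f = cnj (l2inner (T f) (T f))"
      using A f ell2 by (subst l2inner_cnj[symmetric]) (simp add: is_adjoint_def)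
    moreover have "l2inner (T (A f)) f = l2inner (A f) (A f)"
      using A f ell2 by (simp add: is_adjoint_def)
    ultimately show ?thesis
      using l2inner_diff_left[OF ell2(3,4) f] ell2 by (simp add: l2inner_self)
  qed
  then have "Im (l2inner (\<lambda>v. A (T f) v - T (A f) v) f) = 0 \<and>
        0 \<le> Re (l2inner (\<lambda>v. A (T f) v - T (A f) v) f) \<longleftrightarrow> l2norm (A f) \<le> l2norm (T f)"
    if "bounded_on_l2 T" "is_adjoint T A" "ell2 f" for A f
    using that by (simp add: abs_le_square_iff[symmetric] l2norm_nonneg)
  then show ?thesis
    unfolding hyponormal_def by blast
qed

section \<open>Composition, powers and sums of bounded operators and their adjoints\<close>

lemma bounded_on_l2_comp:
  assumes "bounded_on_l2 S" "bounded_on_l2 T"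
  shows "bounded_on_l2 (S \<circ> T)"
proof -
  obtain C D where C: "\<And>f. ell2 f \<Longrightarrow> l2norm (S f) \<le> C * l2norm f"
    and D: "\<And>f. ell2 f \<Longrightarrow> l2norm (T f) \<le> D * l2norm f"
    using assms by (auto simp: bounded_on_l2_def)
  have "l2norm (S (T f)) \<le> (\<bar>C\<bar> * D) * l2norm f" if f: "ell2 f" for f
  proof -
    have "l2norm (S (T f)) \<le> C * l2norm (T f)"
      using assms(2) f by (intro C) (auto simp: bounded_on_l2_def)
    also have "\<dots> \<le> \<bar>C\<bar> * l2norm (T f)"
      by (simp add: l2norm_nonneg mult_right_mono)
    also have "\<dots> \<le> \<bar>C\<bar> * (D * l2norm f)"
      by (simp add: D f mult_left_mono)
    finally show ?thesis by simp
  qed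
  then show ?thesis using assms by (auto simp: bounded_on_l2_def)
qed

lemma bounded_on_l2_funpow: "bounded_on_l2 T \<Longrightarrow> bounded_on_l2 (T ^^ n)"
proof (induction n)
  case 0
  show ?case by (auto simp: bounded_on_l2_def intro!: exI[of _ 1])
qed (simp add: bounded_on_l2_comp)

lemma is_adjoint_funpow:
  assumes "bounded_on_l2 T" "is_adjoint T A"
  shows "is_adjoint (T ^^ n) (A ^^ n)"
proof (induction n)
  case 0
  show ?case by (simp add: is_adjoint_def)
next
  case (Suc n)
  have "ell2 f \<Longrightarrow> ell2 ((T ^^ n) f)" for f
    using bounded_on_l2_funpow[OF assms(1), of n] by (simp add: bounded_on_l2_def)
  moreover have "(A ^^ Suc n) g = (A ^^ n) (A g)" for g
    by (simp add: funpow_swap1)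
  ultimately show ?case
    using Suc assms(2) by (simp add: is_adjoint_def del: funpow.simps(2)) (simp add: is_adjoint_def)
qed

lemma bounded_on_l2_add:
  assumes "bounded_on_l2 S" "bounded_on_l2 T"
  shows "bounded_on_l2 (\<lambda>f v. S f v + T f v)"
proof -
  obtain C D where C: "\<And>f. ell2 f \<Longrightarrow> l2norm (S f) \<le> C * l2norm f"
    and D: "\<And>f. ell2 f \<Longrightarrow> l2norm (T f) \<le> D * l2norm f"
    using assms by (auto simp: bounded_on_l2_def)
  have ell2: "ell2 (S f)" "ell2 (T f)" if "ell2 f" for f
    using assms that by (auto simp: bounded_on_l2_def)
  have "l2norm (\<lambda>v. S f v + T f v) \<le> sqrt (2 * C\<^sup>2 + 2 * D\<^sup>2) * l2norm f" if f: "ell2 f" for f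
  proof (rule power2_le_imp_le)
    have "(l2norm (\<lambda>v. S f v + T f v))\<^sup>2 \<le> 2 * (l2norm (S f))\<^sup>2 + 2 * (l2norm (T f))\<^sup>2"
      using l2norm_add_square_le ell2 f by blast
    also have "\<dots> \<le> 2 * (C * l2norm f)\<^sup>2 + 2 * (D * l2norm f)\<^sup>2"
      by (intro add_mono mult_left_mono power_mono C D f l2norm_nonneg) auto
    also have "\<dots> = (sqrt (2 * C\<^sup>2 + 2 * D\<^sup>2) * l2norm f)\<^sup>2"
      by (simp add: power_mult_distrib algebra_simps)
    finally show "(l2norm (\<lambda>v. S f v + T f v))\<^sup>2 \<le> (sqrt (2 * C\<^sup>2 + 2 * D\<^sup>2) * l2norm f)\<^sup>2" .
  qed (simp add: l2norm_nonneg)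
  then show ?thesis
    unfolding bounded_on_l2_def using ell2 ell2_add by metis
qed

lemma is_adjoint_add:
  assumes "bounded_on_l2 S" "bounded_on_l2 T" "is_adjoint S A" "is_adjoint T B"
  shows "is_adjoint (\<lambda>f v. S f v + T f v) (\<lambda>g v. A g v + B g v)"
  using assms by (auto simp: is_adjoint_def bounded_on_l2_def ell2_add l2inner_add_left l2inner_add_right)

section \<open>Unit vectors and the entries of an adjoint\<close>

definition unit_vec :: "'v \<Rightarrow> 'v \<Rightarrow> complex" where
  "unit_vec u = (\<lambda>v. if v = u then 1 else 0)"

lemma ell2_unit_vec: "ell2 (unit_vec u)" and l2norm_unit_vec: "l2norm (unit_vec u) = 1"
proof -
  have *: "x \<notin> {u} \<Longrightarrow> unit_vec u x = 0" for x by (simp add: unit_vec_def)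
  show "ell2 (unit_vec u)" "l2norm (unit_vec u) = 1"
    using ell2_support[of "{u}" "unit_vec u", OF *] by (auto simp: l2norm_def unit_vec_def)
qed

text \<open>Pairing \<open>A g\<close> with a unit vector reads off a coordinate and moves the
  operator to \<open>T\<close>. Thus any adjoint supplied by \<open>hyponormal\<close> is known
  explicitly.\<close>

lemma adjoint_apply:
  assumes "is_adjoint T A" "ell2 g"
  shows "A g u = l2inner g (T (unit_vec u))"
proof -
  have "cnj (A g u) = l2inner (unit_vec u) (A g)"
    unfolding l2inner_def by (subst infsum_single[of u]) (auto simp: unit_vec_def)
  also have "\<dots> = l2inner (T (unit_vec u)) g"
    using assms ell2_unit_vec[of u] by (simp add: is_adjoint_def)
  finally show ?thesis by (metis complex_cnj_cnj l2inner_cnj)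
qed

lemma adjoint_unit_vec_apply:
  assumes "is_adjoint T A"
  shows "A (unit_vec w) u = cnj (T (unit_vec u) w)"
proof -
  have "A (unit_vec w) u = l2inner (unit_vec w) (T (unit_vec u))"
    by (rule adjoint_apply[OF assms ell2_unit_vec])
  also have "\<dots> = cnj (T (unit_vec u) w)"
    unfolding l2inner_def by (subst infsum_single[of w]) (auto simp: unit_vec_def)
  finally show ?thesis .
qed

section \<open>The core of a directed forest\<close>

text \<open>The non-roots that have an infinite line of descendants.\<close>

definition core :: "('v \<Rightarrow> 'v) \<Rightarrow> 'v set" where
  "core p = \<Union>{A. \<forall>v\<in>A. p v \<noteq> v \<and> (\<exists>u\<in>A. p u = v)}"

lemma core_nonroot: "v \<in> core p \<Longrightarrow> p v \<noteq> v"
  by (auto simp: core_def)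

lemma core_child: "v \<in> core p \<Longrightarrow> \<exists>u\<in>core p. p u = v"
proof -
  assume "v \<in> core p"
  then obtain A where A: "\<forall>v\<in>A. p v \<noteq> v \<and> (\<exists>u\<in>A. p u = v)" and "v \<in> A"
    unfolding core_def by blast
  then obtain u where "u \<in> A" "p u = v" by blast
  moreover have "A \<subseteq> core p"
    unfolding core_def by (rule Union_upper) (use A in simp)
  ultimately show ?thesis by blast
qed

text \<open>\<open>core p\<close> is the union of all sets with these two properties. The rule is
  applied to the non-roots of a leafless forest and to the support of hyponormal weights.\<close>

lemma core_coinduct:
  assumes "\<And>v. v \<in> A \<Longrightarrow> p v \<noteq> v" "\<And>v. v \<in> A \<Longrightarrow> \<exists>u\<in>A. p u = v"
  shows "A \<subseteq> core p"
  unfolding core_def by (rule Union_upper) (use assms in simp)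

text \<open>An orbit of \<open>q\<close> follows an orbit of \<open>p\<close>, pausing at times, so
  a cycle of \<open>q\<close> through a vertex that \<open>q\<close> moves would be a cycle of
  \<open>p\<close>.\<close>

lemma thinner_directed_forest:
  assumes p: "directed_forest p" and q: "thinner q p"
  shows "directed_forest q"
proof -
  have ex: "\<exists>k. (q ^^ n) v = (p ^^ k) v" for n v
  proof (induction n)
    case 0
    show ?case by (intro exI[of _ 0]) simp
  next
    case (Suc n)
    then obtain k where "(q ^^ n) v = (p ^^ k) v" by blast
    moreover have "q ((p ^^ k) v) \<in> {(p ^^ k) v, (p ^^ Suc k) v}"
      using q by (auto simp: thinner_def)
    ultimately show ?case by (metis comp_apply empty_iff funpow.simps(2) insert_iff)
  qed
  have "q v = v" if n: "n \<ge> 1" and cyc: "(q ^^ n) v = v" for n v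
  proof (rule ccontr)
    assume "q v \<noteq> v"
    then have qp: "q v = p v" using q by (auto simp: thinner_def)
    obtain m where m: "n = Suc m" using n by (cases n) auto
    \<comment> \<open>The first step is a genuine step of \<open>p\<close>. Keeping it separate
      guarantees a positive exponent, even if the remaining \<open>k\<close> is 0.\<close>
    have "(q ^^ m) (p v) = v"
      using cyc qp by (simp add: m funpow_swap1)
    then obtain k where "(p ^^ k) (p v) = v" using ex by metis
    then have "(p ^^ Suc k) v = v" by (simp add: funpow_swap1)
    then have "p v = v" using p unfolding directed_forest_def by (metis le_add1 plus_1_eq_Suc)
    then show False using \<open>q v \<noteq> v\<close> qp by simp
  qed
  then show ?thesis by (auto simp: directed_forest_def)
qed

section \<open>Leafless forests thinner than \<open>p\<close>\<close>

lemma leafless_iff: "leafless q \<longleftrightarrow> (\<forall>v. \<exists>u. q u = v)"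
  by (auto simp: leafless_def surj_def eq_commute)

text \<open>A preimage \<open>u\<close> of a vertex \<open>v\<close> moved by \<open>q\<close> is
  moved as well, since \<open>q u = u\<close> would force \<open>u = v\<close>. So the non-roots of
  \<open>q\<close> satisfy the coinduction rule.\<close>

lemma leafless_nonroots_subset_core:
  assumes "leafless q" "thinner q p"
  shows "{v. q v \<noteq> v} \<subseteq> core p"
proof (rule core_coinduct)
  fix v assume v: "v \<in> {v. q v \<noteq> v}"
  show "p v \<noteq> v" using v assms(2) by (auto simp: thinner_def)
  obtain u where "q u = v"
    using assms(1) unfolding leafless_iff by blast
  moreover from this v have "q u \<noteq> u" by fastforce
  moreover from this have "q u = p u" using assms(2) by (auto simp: thinner_def)
  ultimately show "\<exists>u\<in>{v. q v \<noteq> v}. p u = v" by (intro bexI[of _ u]) simp_all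
qed

text \<open>Following \<open>p\<close> exactly on the core gives a leafless forest: a core vertex
  has a child in the core, and any other vertex is its own image. It is greatest because every
  competitor moves only core vertices.\<close>

lemma leafless_support_eq:
  assumes "directed_forest p"
  shows "leafless_support p = (\<lambda>v. if v \<in> core p then p v else v)"
proof -
  let ?q = "\<lambda>v. if v \<in> core p then p v else v"
  have thin: "thinner ?q p" by (auto simp: thinner_def)
  have "\<exists>u. ?q u = v" for v
    using core_child[of v p] by (cases "v \<in> core p") auto
  then have leafl: "leafless ?q" unfolding leafless_iff by blast
  have max: "thinner q ?q" if "leafless q" "thinner q p" for q
    unfolding thinner_def
  proof
    fix v
    have "q v = v" if "v \<notin> core p"
      using leafless_nonroots_subset_core[OF \<open>leafless q\<close> \<open>thinner q p\<close>] that by blast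
    moreover have "q v \<in> {v, p v}" using \<open>thinner q p\<close> by (simp add: thinner_def)
    ultimately show "q v \<in> {v, ?q v}" by simp
  qed
  show ?thesis
    unfolding leafless_support_def
  proof (rule the_equality)
    show "directed_forest ?q \<and> leafless ?q \<and> thinner ?q p \<and>
        (\<forall>q'. directed_forest q' \<and> leafless q' \<and> thinner q' p \<longrightarrow> thinner q' ?q)"
      using thinner_directed_forest[OF assms thin] thin leafl max by blast
  next
    fix q
    assume "directed_forest q \<and> leafless q \<and> thinner q p \<and>
        (\<forall>q'. directed_forest q' \<and> leafless q' \<and> thinner q' p \<longrightarrow> thinner q' q)"
    then have "thinner ?q q" "thinner q ?q"
      using thinner_directed_forest[OF assms thin] thin leafl max by blast+
    then have "q v \<in> {v, ?q v} \<and> ?q v \<in> {v, q v}" for v by (simp add: thinner_def)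
    then have "q v = ?q v" for v by (metis empty_iff insert_iff)
    then show "q = ?q" by (rule ext)
  qed
qed

text \<open>A child of \<open>v\<close> under \<open>q\<close> is moved by \<open>q\<close>, and on
  moved vertices \<open>q\<close> agrees with \<open>p\<close>.\<close>

lemma forkless_iff:
  assumes "thinner q p"
  shows "forkless q \<longleftrightarrow> (\<forall>v. q v \<noteq> v \<longrightarrow> (\<exists>!u. q u \<noteq> u \<and> p u = v))"
proof -
  have "Chi q v = {u. q u \<noteq> u \<and> p u = v}" if "q v \<noteq> v" for v
    using assms unfolding Chi_def thinner_def by (intro Collect_cong) (metis empty_iff insert_iff)
  moreover have "card S = 1 \<longleftrightarrow> (\<exists>!u. u \<in> S)" for S :: "'a set"
    by (auto simp: card_1_singleton_iff)
  ultimately show ?thesis by (simp add: forkless_def roots_def)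
qed

lemma forkless_leafless_support_iff:
  assumes "directed_forest p"
  shows "forkless (leafless_support p) \<longleftrightarrow> (\<forall>v\<in>core p. \<exists>!u. u \<in> core p \<and> p u = v)"
proof -
  have "thinner (leafless_support p) p"
    by (auto simp: leafless_support_eq[OF assms] thinner_def)
  moreover have "leafless_support p v \<noteq> v \<longleftrightarrow> v \<in> core p" for v
    by (auto simp: leafless_support_eq[OF assms] core_nonroot)
  ultimately show ?thesis by (simp add: forkless_iff[of _ p] Ball_def)
qed

text \<open>A leafless \<open>q\<close> provides the child, and the core, containing all non-roots
  of \<open>q\<close>, its uniqueness. Conversely, the leafless support is one of the forests
  \<open>q\<close>.\<close>

lemma forkless_support_iff_thinner_forkless:
  assumes p: "directed_forest p"
  shows "forkless (leafless_support p) \<longleftrightarrow>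
    (\<forall>q. directed_forest q \<and> leafless q \<and> thinner q p \<longrightarrow> forkless q)" (is "?L \<longleftrightarrow> ?R")
proof
  assume ?L
  then have L: "\<forall>v\<in>core p. \<exists>!u. u \<in> core p \<and> p u = v"
    by (rule forkless_leafless_support_iff[OF p, THEN iffD1])
  show ?R
  proof (intro allI impI)
    fix q assume q: "directed_forest q \<and> leafless q \<and> thinner q p"
    then have sub: "{v. q v \<noteq> v} \<subseteq> core p"
      using leafless_nonroots_subset_core by blast
    have "\<exists>!u. q u \<noteq> u \<and> p u = v" if v: "q v \<noteq> v" for v
    proof -
      obtain u where u: "q u = v" using q unfolding leafless_iff by blast
      with v have "q u \<noteq> u" by metis
      moreover have "p u = v" using \<open>q u \<noteq> u\<close> u q unfolding thinner_def by (metis empty_iff insert_iff)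
      moreover have "\<exists>!u. u \<in> core p \<and> p u = v"
        by (rule L[rule_format]) (use sub v in auto)
      ultimately show ?thesis using sub by blast
    qed
    then show "forkless q" using q by (subst forkless_iff[of q p]) auto
  qed
next
  assume R: ?R
  have thin: "thinner (leafless_support p) p"
    by (auto simp: leafless_support_eq[OF p] thinner_def)
  have "\<exists>u. leafless_support p u = v" for v
    using core_child[of v p] by (cases "v \<in> core p") (auto simp: leafless_support_eq[OF p])
  then have "leafless (leafless_support p)" unfolding leafless_iff by blast
  then show ?L using R thin thinner_directed_forest[OF p thin] by blast
qed

text \<open>Reaching \<open>v\<close> after two different numbers of steps would close a cycle of
  \<open>p\<close> through \<open>v\<close>, which only a root allows. The exponent is the depth of
  \<open>x\<close> below \<open>v\<close>.\<close>

lemma depth_unique: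
  assumes p: "directed_forest p" and v: "p v \<noteq> v" and i: "(p ^^ i) x = v" and j: "(p ^^ j) x = v"
  shows "i = j"
proof -
  have less: False if "i < j" "(p ^^ i) x = v" "(p ^^ j) x = v" for i j
  proof -
    have "(p ^^ (j - i)) ((p ^^ i) x) = (p ^^ j) x"
      using that(1) by (metis comp_apply funpow_add le_add_diff_inverse2 less_imp_le)
    then have "(p ^^ (j - i)) v = v" using that by simp
    moreover have "1 \<le> j - i" using that(1) by simp
    ultimately show False using p v unfolding directed_forest_def by blast
  qed
  show ?thesis using less[of i j] less[of j i] i j by (cases i j rule: linorder_cases) auto
qed

lemma funpow_right_inverse:
  assumes s: "\<forall>x\<in>C. s x \<in> C \<and> p (s x) = x" and x: "x \<in> C"
  shows "(s ^^ k) x \<in> C" and "i \<le> k \<Longrightarrow> (p ^^ i) ((s ^^ k) x) = (s ^^ (k - i)) x"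
proof -
  show mem: "(s ^^ k) x \<in> C" for k
    using assms by (induction k) simp_all
  show "i \<le> k \<Longrightarrow> (p ^^ i) ((s ^^ k) x) = (s ^^ (k - i)) x"
  proof (induction i)
    case (Suc i)
    then have "k - i = Suc (k - Suc i)" by simp
    then have "p ((s ^^ (k - i)) x) = (s ^^ (k - Suc i)) x"
      using s mem by simp
    then show ?case using Suc by simp
  qed simp
qed

section \<open>Hyponormal weighted shifts without forks\<close>

lemma wshift_funpow:
  "(wshift p lam ^^ n) f v = (\<Prod>i<n. lam ((p ^^ i) v)) * f ((p ^^ n) v)"
proof (induction n arbitrary: v)
  case (Suc n)
  have "(wshift p lam ^^ Suc n) f v = lam v * (wshift p lam ^^ n) f (p v)"
    by (simp add: wshift_def)
  also have "\<dots> = (lam v * (\<Prod>i<n. lam ((p ^^ i) (p v)))) * f ((p ^^ n) (p v))"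
    by (simp add: Suc)
  also have "\<dots> = (\<Prod>i<Suc n. lam ((p ^^ i) v)) * f ((p ^^ Suc n) v)"
    by (simp only: prod.lessThan_Suc_shift) (simp add: funpow_swap1)
  finally show ?case .
qed simp

text \<open>Without such a child, \<open>S e_v = 0\<close>, hence \<open>A e_v = 0\<close> by
  hyponormality; but the entry of \<open>A e_v\<close> at \<open>p v\<close> is the conjugate of
  \<open>lam v\<close>.\<close>

lemma hyponormal_support_child:
  assumes T: "is_adjoint (wshift p lam) A"
    and hyp: "\<forall>f. ell2 f \<longrightarrow> l2norm (A f) \<le> l2norm (wshift p lam f)"
    and v: "lam v \<noteq> 0"
  shows "\<exists>u. lam u \<noteq> 0 \<and> p u = v"
proof (rule ccontr)
  assume "\<not> ?thesis"
  then have "wshift p lam (unit_vec v) = (\<lambda>_. 0)"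
    by (auto simp: wshift_def unit_vec_def fun_eq_iff)
  then have "l2norm (A (unit_vec v)) \<le> 0"
    using hyp[rule_format, OF ell2_unit_vec[of v]] by (simp add: l2norm_def)
  moreover have "ell2 (A (unit_vec v))"
    using T by (simp add: is_adjoint_def ell2_unit_vec)
  ultimately have "cmod (A (unit_vec v) (p v)) \<le> 0"
    using cmod_le_l2norm[of "A (unit_vec v)" "p v"] by linarith
  then have "A (unit_vec v) (p v) = 0" by simp
  then show False
    using v unfolding adjoint_unit_vec_apply[OF T] by (simp add: wshift_def unit_vec_def)
qed

text \<open>The entry of \<open>A e_v\<close> at \<open>p v\<close> has modulus
  \<open>|lam v|\<close>, whereas \<open>S e_v\<close> is concentrated at \<open>u\<close> with norm
  \<open>|lam u|\<close>.\<close>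

lemma hyponormal_wshift_mono:
  assumes T: "is_adjoint (wshift p lam) A"
    and hyp: "\<forall>f. ell2 f \<longrightarrow> l2norm (A f) \<le> l2norm (wshift p lam f)"
    and u: "\<And>x. lam x \<noteq> 0 \<Longrightarrow> p x = v \<Longrightarrow> x = u" "p u = v"
  shows "cmod (lam v) \<le> cmod (lam u)"
proof -
  have "cmod (lam v) = cmod (A (unit_vec v) (p v))"
    unfolding adjoint_unit_vec_apply[OF T] by (simp add: wshift_def unit_vec_def)
  also have "\<dots> \<le> l2norm (A (unit_vec v))"
    using T by (intro cmod_le_l2norm) (simp add: is_adjoint_def ell2_unit_vec)
  also have "\<dots> \<le> l2norm (wshift p lam (unit_vec v))"
    by (rule hyp[rule_format, OF ell2_unit_vec])
  also have "wshift p lam (unit_vec v) = (\<lambda>x. lam u * unit_vec u x)"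
    using u by (force simp: wshift_def unit_vec_def fun_eq_iff)
  also have "l2norm \<dots> = cmod (lam u)"
    by (simp add: l2norm_cmult l2norm_unit_vec)
  finally show ?thesis .
qed

text \<open>The exponent has the form \<open>Suc m\<close> because one adjoint is split off:
  hyponormality is applied to a truncation of \<open>A^m f\<close>, and the rest is a comparison of
  weights. \<open>uniq\<close> concerns only parents in the core, as roots of the leafless support
  may have several core children.\<close>

lemma hyponormal_funpow_wshift:
  assumes w: "weights p lam" and hyp: "hyponormal (wshift p lam)"
    and uniq: "\<And>x y. \<lbrakk>x \<in> core p; y \<in> core p; p x = p y; p x \<in> core p\<rbrakk> \<Longrightarrow> x = y"
  shows "hyponormal (wshift p lam ^^ Suc m)"
proof -
  let ?S = "wshift p lam"
  define B where "B = {v. lam v \<noteq> 0}"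
  have B: "v \<in> B \<longleftrightarrow> lam v \<noteq> 0" for v by (simp add: B_def)
  obtain A where bdd: "bounded_on_l2 ?S" and A: "is_adjoint ?S A"
    and le: "\<forall>f. ell2 f \<longrightarrow> l2norm (A f) \<le> l2norm (?S f)"
    using hyp by (auto simp: hyponormal_iff)
  have child: "\<exists>u. u \<in> B \<and> p u = v" if "v \<in> B" for v
    using hyponormal_support_child[OF A le] that by (auto simp: B)
  have "B \<subseteq> core p"
  proof (rule core_coinduct)
    show "v \<in> B \<Longrightarrow> p v \<noteq> v" for v using w by (auto simp: B weights_def roots_def)
    show "v \<in> B \<Longrightarrow> \<exists>u\<in>B. p u = v" for v using child by blast
  qed
  then have uniqB: "x = y" if "x \<in> B" "y \<in> B" "p x = p y" "p x \<in> B" for x y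
    by (intro uniq[OF _ _ that(3)]) (use that in blast)+
  \<comment> \<open>On \<open>B\<close>, \<open>s\<close> picks the only child with nonzero weight;
    uniqueness comes from \<open>uniqB\<close>, as the parent lies in \<open>B\<close>.\<close>
  define s where "s v = (SOME u. u \<in> B \<and> p u = v)" for v
  have s: "\<forall>v\<in>B. s v \<in> B \<and> p (s v) = v"
    unfolding s_def by (intro ballI someI_ex[OF child])
  then have sB: "s v \<in> B" and ps: "p (s v) = v" if "v \<in> B" for v
    using that by blast+
  have s_unique: "x = s v" if "x \<in> B" "v \<in> B" "p x = v" for x v
    using uniqB[of x "s v"] that sB ps by simp
  note iter = funpow_right_inverse[of B s p, OF s]
  have mono_step: "cmod (lam v) \<le> cmod (lam (s v))" if "v \<in> B" for v
    by (rule hyponormal_wshift_mono[OF A le]) (use that s_unique ps B in blast)+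
  have mono: "cmod (lam ((s ^^ i) v)) \<le> cmod (lam ((s ^^ j) v))" if "i \<le> j" "v \<in> B" for i j v
    using that(1)
  proof (induction rule: dec_induct)
    case (step j)
    then show ?case
      using mono_step[OF iter(1)[OF that(2), of j]] by simp
  qed simp
  have ellA: "ell2 g \<Longrightarrow> ell2 (A g)" for g using A by (simp add: is_adjoint_def)
  \<comment> \<open>In the sum for the adjoint at \<open>v\<close> only the child \<open>s v\<close>
    survives, so on \<open>B\<close> the operator \<open>A\<close> is a weighted backward
    shift.\<close>
  have A_at: "A g v = cnj (lam (s v)) * g (s v)" if "ell2 g" "v \<in> B" for g v
  proof -
    have "A g v = (\<Sum>\<^sub>\<infinity>x. g x * cnj (?S (unit_vec v) x))"
      using adjoint_apply[OF A that(1)] by (simp add: l2inner_def)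
    also have "\<dots> = g (s v) * cnj (?S (unit_vec v) (s v))"
    proof (rule infsum_single)
      fix x assume "x \<noteq> s v"
      then show "g x * cnj (?S (unit_vec v) x) = 0"
        using s_unique[of x v] that(2) by (auto simp: B wshift_def unit_vec_def)
    qed
    also have "\<dots> = cnj (lam (s v)) * g (s v)"
      using ps that by (simp add: wshift_def unit_vec_def)
    finally show ?thesis .
  qed
  have ellAn: "ell2 ((A ^^ n) g)" if "ell2 g" for n g
    using that by (induction n) (auto simp: ellA)
  have An_at: "(A ^^ n) g v = (\<Prod>i<n. cnj (lam ((s ^^ Suc i) v))) * g ((s ^^ n) v)"
    if "ell2 g" "v \<in> B" for n g v
    using that(2)
  proof (induction n arbitrary: v)
    case (Suc n)
    have "(A ^^ Suc n) g v = cnj (lam (s v)) * (A ^^ n) g (s v)"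
      using A_at ellAn that Suc.prems by simp
    also have "\<dots> = (cnj (lam (s v)) * (\<Prod>i<n. cnj (lam ((s ^^ Suc i) (s v))))) * g ((s ^^ n) (s v))"
      using Suc.IH[OF sB[OF Suc.prems]] by simp
    also have "\<dots> = (\<Prod>i<Suc n. cnj (lam ((s ^^ Suc i) v))) * g ((s ^^ Suc n) v)"
      by (simp only: prod.lessThan_Suc_shift) (simp add: funpow_swap1)
    finally show ?case .
  qed simp
  have main: "l2norm ((A ^^ Suc m) f) \<le> l2norm ((?S ^^ Suc m) f)" if f: "ell2 f" for f
  proof -
    define g where "g = (A ^^ m) f"
    \<comment> \<open>Truncating to \<open>B\<close> does not affect \<open>A\<close>, since
      \<open>S e_u\<close> vanishes off \<open>B\<close> for every \<open>u\<close>, and it makes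
      \<open>A^m f\<close> explicit wherever \<open>h\<close> is nonzero.\<close>
    define h where "h v = (if v \<in> B then g v else 0)" for v
    have g: "ell2 g" unfolding g_def by (rule ellAn[OF f])
    have h: "ell2 h"
      by (rule l2norm_le_inj(1)[OF g, of id B]) (auto simp: h_def)
    have "A g = A h"
    proof
      fix u
      show "A g u = A h u"
        unfolding adjoint_apply[OF A g] adjoint_apply[OF A h] l2inner_def
        by (rule infsum_cong) (simp add: h_def B wshift_def)
    qed
    then have "l2norm ((A ^^ Suc m) f) = l2norm (A h)" by (simp add: g_def)
    also have "\<dots> \<le> l2norm (?S h)" by (rule le[rule_format, OF h])
    also have "\<dots> \<le> l2norm ((?S ^^ Suc m) f)"
    proof (rule l2norm_le_inj(2))
      show "ell2 ((?S ^^ Suc m) f)"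
        using bounded_on_l2_funpow[OF bdd, of "Suc m"] f by (simp add: bounded_on_l2_def)
      \<comment> \<open>At \<open>x = s v\<close> the function \<open>S h\<close> involves the value
        of \<open>f\<close> at \<open>s^m v\<close>. The power \<open>S^(m+1) f\<close> uses the
        same value \<open>m + 1\<close> generations below that, at
        \<open>s^(2m+1) v = s^(2m) x\<close>.\<close>
      show "inj_on (s ^^ (2 * m)) (s ` B)"
        by (rule inj_on_inverseI[of _ "p ^^ (2 * m)"]) (use iter(2) sB in auto)
      show "?S h x = 0" if "x \<notin> s ` B" for x
        using that s_unique[of x "p x"] by (auto simp: wshift_def h_def B)
      fix x assume "x \<in> s ` B"
      then obtain v where v: "v \<in> B" and x: "x = s v" by auto
      \<comment> \<open>\<open>?L\<close> separates the weights: both sides have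
        \<open>m + 1\<close> factors, with indices at most \<open>m + 1\<close> on the left and from
        \<open>m + 1\<close> to \<open>2m + 1\<close> on the right.\<close>
      let ?L = "cmod (lam ((s ^^ Suc m) v))"
      have "cmod (?S h x) = cmod (lam (s v)) * cmod (h v)"
        using x ps[OF v] by (simp add: wshift_def norm_mult)
      also have "h v = (\<Prod>i<m. cnj (lam ((s ^^ Suc i) v))) * f ((s ^^ m) v)"
        using v An_at[OF f v] by (simp add: h_def g_def)
      also have "cmod (lam (s v)) * cmod \<dots> =
          cmod (lam (s v)) * (\<Prod>i<m. cmod (lam ((s ^^ Suc i) v))) * cmod (f ((s ^^ m) v))"
        by (simp add: norm_mult prod_norm[symmetric])
      also have "\<dots> \<le> ?L * (\<Prod>i<m. ?L) * cmod (f ((s ^^ m) v))"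
      proof (intro mult_right_mono mult_mono prod_mono conjI)
        show "cmod (lam (s v)) \<le> ?L" using mono[of 1 "Suc m" v] v by simp
        show "cmod (lam ((s ^^ Suc i) v)) \<le> ?L" if "i \<in> {..<m}" for i
          using mono[of "Suc i" "Suc m" v] v that by simp
      qed (auto intro: prod_nonneg)
      also have "?L * (\<Prod>i<m. ?L) = (\<Prod>i<Suc m. ?L)" by simp
      also have "\<dots> * cmod (f ((s ^^ m) v))
          \<le> (\<Prod>i<Suc m. cmod (lam ((s ^^ (2 * m + 1 - i)) v))) * cmod (f ((s ^^ m) v))"
      proof (intro mult_right_mono prod_mono conjI)
        show "?L \<le> cmod (lam ((s ^^ (2 * m + 1 - i)) v))" if "i \<in> {..<Suc m}" for i
          by (rule mono) (use v that in auto)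
      qed auto
      also have "\<dots> = cmod ((?S ^^ Suc m) f ((s ^^ (2 * m + 1)) v))"
      proof -
        have "(p ^^ i) ((s ^^ (2 * m + 1)) v) = (s ^^ (2 * m + 1 - i)) v" if "i \<le> Suc m" for i
          using that by (intro iter(2)[OF v]) auto
        moreover have "2 * m + 1 - Suc m = m" by simp
        ultimately show ?thesis
          unfolding wshift_funpow norm_mult prod_norm[symmetric] by (simp del: funpow.simps)
      qed
      also have "(s ^^ (2 * m + 1)) v = (s ^^ (2 * m)) x"
        by (simp add: x funpow_swap1)
      finally show "cmod (?S h x) \<le> cmod ((?S ^^ Suc m) f ((s ^^ (2 * m)) x))" .
    qed
    finally show ?thesis .
  qed
  show ?thesis
    unfolding hyponormal_iff
    using bounded_on_l2_funpow[OF bdd] is_adjoint_funpow[OF bdd A] main by blast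
qed

section \<open>A fork in the core\<close>

text \<open>The adjoint of \<open>wshift p mu\<close> for bounded \<open>mu\<close> with
  \<open>p\<close> injective on its support: \<open>inv_into\<close> then finds the only child of
  \<open>w\<close> in the support, and 0 is the value where there is none.\<close>

definition branch_adjoint :: "('v \<Rightarrow> 'v) \<Rightarrow> ('v \<Rightarrow> complex) \<Rightarrow> ('v \<Rightarrow> complex) \<Rightarrow> 'v \<Rightarrow> complex" where
  "branch_adjoint p mu g w = (if w \<in> p ` {x. mu x \<noteq> 0}
     then cnj (mu (inv_into {x. mu x \<noteq> 0} p w)) * g (inv_into {x. mu x \<noteq> 0} p w) else 0)"

context
  fixes p :: "'v \<Rightarrow> 'v" and mu :: "'v \<Rightarrow> complex"
  assumes inj: "inj_on p {x. mu x \<noteq> 0}"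
begin

lemma branch_adjoint_parent:
  "mu x \<noteq> 0 \<Longrightarrow> branch_adjoint p mu g (p x) = cnj (mu x) * g x"
  unfolding branch_adjoint_def using inv_into_f_f[OF inj, of x] by simp

lemma branch_adjoint_outside:
  "w \<notin> p ` {x. mu x \<noteq> 0} \<Longrightarrow> branch_adjoint p mu g w = 0"
  by (simp add: branch_adjoint_def)

lemma branch_infsum:
  assumes "\<And>w. w \<notin> p ` {x. mu x \<noteq> 0} \<Longrightarrow> h w = 0"
  shows "(\<Sum>\<^sub>\<infinity>w. h w) = (\<Sum>\<^sub>\<infinity>x\<in>{x. mu x \<noteq> 0}. h (p x))"
proof -
  have "(\<Sum>\<^sub>\<infinity>w. h w) = (\<Sum>\<^sub>\<infinity>w\<in>p ` {x. mu x \<noteq> 0}. h w)"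
    by (rule infsum_cong_neutral) (use assms in auto)
  then show ?thesis by (simp add: infsum_reindex[OF inj] o_def)
qed

lemma branch_adjoint_sq_sum:
  "(\<Sum>\<^sub>\<infinity>w. (cmod (branch_adjoint p mu g w))\<^sup>2) =
    (\<Sum>\<^sub>\<infinity>x\<in>{x. mu x \<noteq> 0}. (cmod (mu x * g x))\<^sup>2)"
proof -
  have "(\<Sum>\<^sub>\<infinity>w. (cmod (branch_adjoint p mu g w))\<^sup>2) =
      (\<Sum>\<^sub>\<infinity>x\<in>{x. mu x \<noteq> 0}. (cmod (branch_adjoint p mu g (p x)))\<^sup>2)"
    by (rule branch_infsum) (simp add: branch_adjoint_outside)
  also have "\<dots> = (\<Sum>\<^sub>\<infinity>x\<in>{x. mu x \<noteq> 0}. (cmod (mu x * g x))\<^sup>2)"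
    by (rule infsum_cong) (simp add: branch_adjoint_parent norm_mult)
  finally show ?thesis .
qed

text \<open>By injectivity each value of \<open>f\<close> occurs at most once with nonzero weight,
  so a bound on the weights bounds the operator.\<close>

lemma branch_bounded:
  assumes M: "\<And>x. cmod (mu x) \<le> M"
  shows "bounded_on_l2 (wshift p mu)"
proof -
  have M0: "0 \<le> M" using M[of undefined] norm_ge_zero order_trans by metis
  have "ell2 (wshift p mu f) \<and> l2norm (wshift p mu f) \<le> M * l2norm f" if f: "ell2 f" for f
  proof -
    have "cmod (wshift p mu f x) \<le> cmod (of_real M * f (p x))" for x
      using M[of x] M0 by (simp add: wshift_def norm_mult mult_right_mono)
    moreover have "wshift p mu f x = 0" if "x \<notin> {x. mu x \<noteq> 0}" for x
      using that by (simp add: wshift_def)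
    ultimately show ?thesis
      using l2norm_le_inj[OF ell2_cmult[OF f, of "of_real M"] inj, of "wshift p mu f"] M0
      by (simp add: l2norm_cmult)
  qed
  then show ?thesis unfolding bounded_on_l2_def by blast
qed

lemma branch_is_adjoint:
  assumes M: "\<And>x. cmod (mu x) \<le> M"
  shows "is_adjoint (wshift p mu) (branch_adjoint p mu)"
  unfolding is_adjoint_def
proof (intro conjI allI impI)
  have M0: "0 \<le> M" using M[of undefined] norm_ge_zero order_trans by metis
  let ?B = "{x. mu x \<noteq> 0}"
  fix g :: "'v \<Rightarrow> complex" assume g: "ell2 g"
  show "ell2 (branch_adjoint p mu g)"
  proof (rule l2norm_le_inj(1)[OF ell2_cmult[OF g, of "of_real M"]])
    show "inj_on (inv_into ?B p) (p ` ?B)" by (rule inj_on_inv_into) simp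
    fix w assume "w \<in> p ` ?B"
    then show "cmod (branch_adjoint p mu g w) \<le> cmod (of_real M * g (inv_into ?B p w))"
      using M M0 by (simp add: branch_adjoint_def norm_mult mult_right_mono)
  qed (rule branch_adjoint_outside)
next
  fix f g :: "'v \<Rightarrow> complex" assume "ell2 f" "ell2 g"
  have "l2inner (wshift p mu f) g = (\<Sum>\<^sub>\<infinity>x\<in>{x. mu x \<noteq> 0}. wshift p mu f x * cnj (g x))"
    unfolding l2inner_def by (rule infsum_cong_neutral) (auto simp: wshift_def)
  also have "\<dots> = (\<Sum>\<^sub>\<infinity>x\<in>{x. mu x \<noteq> 0}. f (p x) * cnj (branch_adjoint p mu g (p x)))"
    by (rule infsum_cong) (simp add: branch_adjoint_parent wshift_def)
  also have "\<dots> = l2inner f (branch_adjoint p mu g)"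
    unfolding l2inner_def by (rule branch_infsum[symmetric]) (simp add: branch_adjoint_outside)
  finally show "l2inner (wshift p mu f) g = l2inner f (branch_adjoint p mu g)" .
qed

end

text \<open>As \<open>a\<close> and \<open>b\<close> share a parent, \<open>p\<close> is not
  injective on the support of the weights. They are therefore split into two parts, one per branch,
  whose adjoints are explicit and add up.\<close>

lemma fork_square_not_hyponormal:
  fixes p :: "'v \<Rightarrow> 'v"
  assumes p: "directed_forest p"
    and v: "v \<in> core p" and a: "a \<in> core p" "p a = v" and b: "b \<in> core p" "p b = v" and "a \<noteq> b"
  shows "\<exists>lam. weights p lam \<and> hyponormal (wshift p lam) \<and> \<not> hyponormal (wshift p lam ^^ 2)"
proof -
  obtain s where s: "\<forall>x\<in>core p. s x \<in> core p \<and> p (s x) = x"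
    using core_child[of _ p] by metis
  note iter = funpow_right_inverse[OF s]
  have pv: "p v \<noteq> v" using v by (rule core_nonroot)
  note depth = depth_unique[OF p pv]
  \<comment> \<open>The vertices \<open>s^k a\<close> and \<open>s^k b\<close> lie at depth
    \<open>k + 1\<close> below \<open>v\<close>. By \<open>depth\<close> this number is determined
    by the vertex, which keeps the branches apart.\<close>
  define Ba where "Ba = range (\<lambda>k. (s ^^ k) a)"
  define Bb where "Bb = range (\<lambda>k. (s ^^ k) b)"
  have Ba_core: "Ba \<subseteq> core p" and Bb_core: "Bb \<subseteq> core p"
    using iter(1) a(1) b(1) by (auto simp: Ba_def Bb_def)
  have ia: "(p ^^ k) ((s ^^ k) a) = a" and ib: "(p ^^ k) ((s ^^ k) b) = b" for k
    using iter(2)[OF a(1), of k k] iter(2)[OF b(1), of k k] by simp_all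
  have da: "(p ^^ Suc k) ((s ^^ k) a) = v" and db: "(p ^^ Suc k) ((s ^^ k) b) = v" for k
    using ia ib a(2) b(2) by simp_all
  have BaE: "\<exists>k. x = (s ^^ k) a \<and> (p ^^ k) x = a \<and> (p ^^ Suc k) x = v" if "x \<in> Ba" for x
    using that ia da unfolding Ba_def by blast
  have BbE: "\<exists>k. x = (s ^^ k) b \<and> (p ^^ k) x = b \<and> (p ^^ Suc k) x = v" if "x \<in> Bb" for x
    using that ib db unfolding Bb_def by blast
  have v_notin: "v \<notin> Ba" "v \<notin> Bb"
    using BaE[of v] BbE[of v] depth[of 0 v] by fastforce+
  \<comment> \<open>A common vertex would have equal depth on both branches, so its ancestor just
    below \<open>v\<close> would be both \<open>a\<close> and \<open>b\<close>.\<close>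
  have disj: "Ba \<inter> Bb = {}"
  proof (rule ccontr)
    assume "Ba \<inter> Bb \<noteq> {}"
    then obtain x where "x \<in> Ba" "x \<in> Bb" by blast
    then obtain i j where "(p ^^ i) x = a" "(p ^^ Suc i) x = v" "(p ^^ j) x = b" "(p ^^ Suc j) x = v"
      using BaE BbE by blast
    then show False using depth[of "Suc i" x "Suc j"] \<open>a \<noteq> b\<close> by simp
  qed
  have sa: "s x \<in> Ba" "s x \<noteq> a" if x: "x \<in> Ba" for x
  proof -
    obtain k where k: "x = (s ^^ k) a" using BaE[OF x] by blast
    then have sx: "s x = (s ^^ Suc k) a" by simp
    then show "s x \<in> Ba" unfolding Ba_def by blast
    show "s x \<noteq> a" using depth[of "Suc 0" a "Suc (Suc k)"] a(2) da[of "Suc k"] sx by auto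
  qed
  have sb: "s x \<in> Bb" "s x \<noteq> b" if x: "x \<in> Bb" for x
  proof -
    obtain k where k: "x = (s ^^ k) b" using BbE[OF x] by blast
    then have sx: "s x = (s ^^ Suc k) b" by simp
    then show "s x \<in> Bb" unfolding Bb_def by blast
    show "s x \<noteq> b" using depth[of "Suc 0" b "Suc (Suc k)"] b(2) db[of "Suc k"] sx by auto
  qed
  have aBa: "a \<in> Ba" and bBb: "b \<in> Bb"
    unfolding Ba_def Bb_def by (auto intro: range_eqI[of _ _ 0])
  \<comment> \<open>Siblings have the same depth below \<open>v\<close>; \<open>k > 0\<close>
    matters, since equal parents do not make the vertices equal.\<close>
  have same_depth: "(p ^^ k) x = v \<longleftrightarrow> (p ^^ k) y = v" if "p x = p y" "k > 0" for k x y
    using that by (cases k) (simp_all add: funpow_swap1)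
  have v_parent: "p v \<noteq> p x" if x: "x \<in> Ba \<union> Bb" for x
  proof
    assume eq: "p v = p x"
    obtain k where "(p ^^ Suc k) x = v" using x BaE BbE by blast
    then have "(p ^^ Suc k) v = v" using same_depth[OF eq, of "Suc k"] by simp
    then show False using depth[of 0 v "Suc k"] by simp
  qed
  have inj_a: "x = y" if xy: "x \<in> Ba" "y \<in> Ba" "p x = p y" for x y
  proof -
    obtain i j where "x = (s ^^ i) a" "(p ^^ Suc i) x = v" "y = (s ^^ j) a" "(p ^^ Suc j) y = v"
      using BaE xy by blast
    moreover from this have "(p ^^ Suc i) y = v" using same_depth[OF xy(3), of "Suc i"] by simp
    ultimately show "x = y" using depth[of "Suc i" y "Suc j"] by simp
  qed
  have inj_b: "x = y" if xy: "x \<in> Bb" "y \<in> Bb" "p x = p y" for x y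
  proof -
    obtain i j where "x = (s ^^ i) b" "(p ^^ Suc i) x = v" "y = (s ^^ j) b" "(p ^^ Suc j) y = v"
      using BbE xy by blast
    moreover from this have "(p ^^ Suc i) y = v" using same_depth[OF xy(3), of "Suc i"] by simp
    ultimately show "x = y" using depth[of "Suc i" y "Suc j"] by simp
  qed
  \<comment> \<open>Siblings on different branches have equal depth. If they lay deeper than
    \<open>a\<close> and \<open>b\<close>, their common parent would force
    \<open>a = b\<close>.\<close>
  have cross: "x = a \<and> y = b" if xy: "x \<in> Ba" "y \<in> Bb" "p x = p y" for x y
  proof -
    obtain i j where i: "x = (s ^^ i) a" "(p ^^ i) x = a" "(p ^^ Suc i) x = v"
      and j: "y = (s ^^ j) b" "(p ^^ j) y = b" "(p ^^ Suc j) y = v"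
      using BaE BbE xy by blast
    have "(p ^^ Suc i) y = v" using i same_depth[OF xy(3), of "Suc i"] by simp
    then have ij: "i = j" using depth[of "Suc i" y "Suc j"] j by simp
    have "i = 0"
    proof (cases i)
      case (Suc k)
      then have "(p ^^ i) x = (p ^^ i) y" using xy(3) by (simp add: funpow_swap1)
      then show ?thesis using i j ij \<open>a \<noteq> b\<close> by simp
    qed
    then show ?thesis using i j ij by simp
  qed

  txt \<open>The weights are \<open>l1\<close> on the branch of \<open>a\<close> (including \<open>v\<close>) and \<open>l2\<close> on that of \<open>b\<close>, so that
    \<open>p\<close> is injective on each support. The weights \<open>m1\<close> and \<open>m2\<close> are slightly larger: they absorb the
    factor 2 of \<open>cmod_add_square_le\<close> at \<open>v\<close>, the only vertex where the two adjoints interact.\<close>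
  define m1 :: "'v \<Rightarrow> complex" where "m1 x = (if x = v then 2 else if x \<in> Ba then 1 else 0)" for x
  define m2 :: "'v \<Rightarrow> complex" where "m2 x = (if x \<in> Bb then 3 else 0)" for x
  define l1 where "l1 = m1(a := 2 / 3)"
  define l2 where "l2 = m2(b := 2)"
  define lam where "lam x = l1 x + l2 x" for x
  have av: "a \<noteq> v" "b \<noteq> v" using aBa bBb v_notin by auto
  have supp1: "{x. m1 x \<noteq> 0} = insert v Ba" "{x. l1 x \<noteq> 0} = insert v Ba"
    using aBa by (auto simp: m1_def l1_def)
  have supp2: "{x. m2 x \<noteq> 0} = Bb" "{x. l2 x \<noteq> 0} = Bb"
    using bBb by (auto simp: m2_def l2_def)
  have m1_norm: "cmod (m1 x) \<le> 2" and m2_norm: "cmod (m2 x) \<le> 3"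
    and l1_norm: "cmod (l1 x) \<le> 2" and l2_norm: "cmod (l2 x) \<le> 3" for x
    by (auto simp: m1_def m2_def l1_def l2_def)
  have l1_le_m1: "cmod (l1 x) \<le> cmod (m1 x)" and l2_le_m2: "cmod (l2 x) \<le> cmod (m2 x)" for x
    using aBa bBb av by (auto simp: m1_def m2_def l1_def l2_def)
  have at_ab: "l1 a = 2 / 3" "m1 a = 1" "l2 b = 2" "m2 b = 3"
    using av aBa bBb by (simp_all add: m1_def m2_def l1_def l2_def)
  have lam_v: "lam v = 2" using av v_notin by (auto simp: lam_def l1_def l2_def m1_def m2_def)
  have lam_a: "lam a = 2 / 3" using av aBa disj \<open>a \<noteq> b\<close>
    by (auto simp: lam_def l1_def l2_def m1_def m2_def)
  have lam_b: "lam b = 2" using av bBb disj \<open>a \<noteq> b\<close>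
    by (auto simp: lam_def l1_def l2_def m1_def m2_def)
  have lam_Ba: "lam x = 1" if "x \<in> Ba" "x \<noteq> a" for x
    using that bBb v_notin disj by (auto simp: lam_def l1_def l2_def m1_def m2_def)
  have lam_Bb: "lam x = 3" if "x \<in> Bb" "x \<noteq> b" for x
    using that aBa v_notin disj by (auto simp: lam_def l1_def l2_def m1_def m2_def)
  have lam_supp: "x \<in> insert v (Ba \<union> Bb)" if "lam x \<noteq> 0" for x
  proof (rule ccontr)
    assume "x \<notin> insert v (Ba \<union> Bb)"
    then have "l1 x = 0" "l2 x = 0" using supp1(2) supp2(2) by blast+
    then show False using that by (simp add: lam_def)
  qed

  have inj1: "inj_on p {x. m1 x \<noteq> 0}" "inj_on p {x. l1 x \<noteq> 0}"
  proof -
    have "inj_on p Ba" by (rule inj_onI) (rule inj_a)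
    moreover have "p v \<notin> p ` Ba" using v_parent by blast
    ultimately have "inj_on p (insert v Ba)" by (auto simp: inj_on_insert)
    then show "inj_on p {x. m1 x \<noteq> 0}" "inj_on p {x. l1 x \<noteq> 0}" 
      unfolding supp1 by assumption+
  qed
  have inj2: "inj_on p {x. m2 x \<noteq> 0}" "inj_on p {x. l2 x \<noteq> 0}"
    unfolding supp2 by (rule inj_onI, rule inj_b, assumption+)+
  have S_eq: "wshift p lam = (\<lambda>f x. wshift p l1 f x + wshift p l2 f x)"
    by (simp add: fun_eq_iff wshift_def lam_def distrib_right)
  let ?A = "\<lambda>g w. branch_adjoint p l1 g w + branch_adjoint p l2 g w"
  have bdd1: "bounded_on_l2 (wshift p l1)" and bdd2: "bounded_on_l2 (wshift p l2)"
    using branch_bounded[OF inj1(2) l1_norm] branch_bounded[OF inj2(2) l2_norm] .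
  have adj1: "is_adjoint (wshift p l1) (branch_adjoint p l1)"
    and adj2: "is_adjoint (wshift p l2) (branch_adjoint p l2)"
    using branch_is_adjoint[OF inj1(2) l1_norm] branch_is_adjoint[OF inj2(2) l2_norm] .
  have bdd: "bounded_on_l2 (wshift p lam)"
    unfolding S_eq by (rule bounded_on_l2_add[OF bdd1 bdd2])
  have adj: "is_adjoint (wshift p lam) ?A"
    unfolding S_eq by (rule is_adjoint_add[OF bdd1 bdd2 adj1 adj2])
  have le1: "cmod (branch_adjoint p l1 g w) \<le> cmod (branch_adjoint p m1 g w)" for g w
    unfolding branch_adjoint_def supp1 by (simp add: norm_mult mult_right_mono l1_le_m1)
  have le2: "cmod (branch_adjoint p l2 g w) \<le> cmod (branch_adjoint p m2 g w)" for g w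
    unfolding branch_adjoint_def supp2 by (simp add: norm_mult mult_right_mono l2_le_m2)
  have pointwise: "(cmod (?A g w))\<^sup>2 \<le>
      (cmod (branch_adjoint p m1 g w))\<^sup>2 + (cmod (branch_adjoint p m2 g w))\<^sup>2" for g w
  proof (cases "w \<in> p ` insert v Ba \<and> w \<in> p ` Bb")
    case True
    \<comment> \<open>By \<open>v_parent\<close>, \<open>v\<close> has no sibling on the branches,
      so \<open>cross\<close> leaves \<open>v\<close> as the only common parent.\<close>
    then obtain x y where "x \<in> insert v Ba" "w = p x" "y \<in> Bb" "w = p y" by blast
    moreover from this have "x \<noteq> v" using v_parent[of y] by auto
    ultimately have w: "w = p a" "w = p b" using cross[of x y] by auto
    have vall1: "branch_adjoint p l1 g w = 2 / 3 * g a"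
      using branch_adjoint_parent[OF inj1(2), of a g] w at_ab by simp
    have valm1: "branch_adjoint p m1 g w = g a"
      using branch_adjoint_parent[OF inj1(1), of a g] w at_ab by simp
    have vall2: "branch_adjoint p l2 g w = 2 * g b"
      using branch_adjoint_parent[OF inj2(2), of b g] w at_ab by simp
    have valm2: "branch_adjoint p m2 g w = 3 * g b"
      using branch_adjoint_parent[OF inj2(1), of b g] w at_ab by simp
    \<comment> \<open>The weights at \<open>a\<close> and \<open>b\<close> are chosen so that
      \<open>2 * (2/3)^2 = 8/9\<close> is at most 1 and \<open>2 * 2^2 = 8\<close> at most
      \<open>3^2\<close>.\<close>
    have "(cmod (2 / 3 * g a + 2 * g b))\<^sup>2 \<le> 8 / 9 * (cmod (g a))\<^sup>2 + 8 * (cmod (g b))\<^sup>2"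
      using cmod_add_square_le[of "2 / 3 * g a" "2 * g b"]
      by (simp add: norm_mult norm_divide power_mult_distrib power_divide)
    also have "\<dots> \<le> (cmod (g a))\<^sup>2 + (cmod (3 * g b))\<^sup>2"
      by (simp add: norm_mult power_mult_distrib)
    finally show ?thesis by (simp only: vall1 valm1 vall2 valm2)
  next
    case False
    then have "branch_adjoint p l1 g w = 0 \<or> branch_adjoint p l2 g w = 0"
      using branch_adjoint_outside[OF inj1(2), of w g] branch_adjoint_outside[OF inj2(2), of w g]
      by (auto simp: supp1 supp2)
    then show ?thesis
      using power_mono[OF le1[of g w], of 2] power_mono[OF le2[of g w], of 2]
      by (auto intro: add_increasing add_increasing2)
  qed
  have le: "l2norm (?A g) \<le> l2norm (wshift p lam g)" if g: "ell2 g" for g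
  proof -
    have ellA: "ell2 (?A g)" and ellS: "ell2 (wshift p lam g)"
      using adj bdd g by (simp_all add: is_adjoint_def bounded_on_l2_def)
    have ellm: "ell2 (branch_adjoint p m1 g)" "ell2 (branch_adjoint p m2 g)"
      using branch_is_adjoint[OF inj1(1) m1_norm] branch_is_adjoint[OF inj2(1) m2_norm] g
      by (simp_all add: is_adjoint_def)
    \<comment> \<open>\<open>psi\<close> selects for each vertex one child whose weight pays for the
      adjoint. At \<open>v\<close> this is \<open>b\<close>, since \<open>|m1 v| = 2\<close> exceeds
      the weight at \<open>a\<close>.\<close>
    define psi where "psi x = (if x = v then b else s x)" for x
    define e where "e x = (cmod (m1 x * g x))\<^sup>2 + (cmod (m2 x * g x))\<^sup>2" for x
    have p_psi: "p (psi x) = x" if "x \<in> insert v (Ba \<union> Bb)" for x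
      using that s b(2) Ba_core Bb_core by (auto simp: psi_def)
    have e0: "0 \<le> e x" for x by (simp add: e_def)
    have "inj_on psi (insert v (Ba \<union> Bb))"
      by (rule inj_on_inverseI[of _ p]) (rule p_psi)
    moreover have "e x \<le> (cmod (wshift p lam g (psi x)))\<^sup>2" if x: "x \<in> insert v (Ba \<union> Bb)" for x
    proof -
      \<comment> \<open>Equality holds throughout: both sides are 4 at \<open>v\<close>, 1 on
        \<open>Ba\<close> and 9 on \<open>Bb\<close>.\<close>
      have "(cmod (m1 x))\<^sup>2 + (cmod (m2 x))\<^sup>2 \<le> (cmod (lam (psi x)))\<^sup>2"
        using x v_notin disj sa[of x] sb[of x] lam_Ba[of "s x"] lam_Bb[of "s x"] lam_b
        by (auto simp: m1_def m2_def psi_def)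
      then have "((cmod (m1 x))\<^sup>2 + (cmod (m2 x))\<^sup>2) * (cmod (g x))\<^sup>2 \<le>
          (cmod (lam (psi x)))\<^sup>2 * (cmod (g x))\<^sup>2"
        by (rule mult_right_mono) simp
      then show ?thesis
        by (simp add: e_def wshift_def p_psi[OF x] norm_mult power_mult_distrib distrib_right)
    qed
    ultimately have sum: "e summable_on insert v (Ba \<union> Bb)"
        "(\<Sum>\<^sub>\<infinity>x\<in>insert v (Ba \<union> Bb). e x) \<le> (\<Sum>\<^sub>\<infinity>x. (cmod (wshift p lam g x))\<^sup>2)"
      using summable_infsum_le_inj[of "\<lambda>x. (cmod (wshift p lam g x))\<^sup>2" psi "insert v (Ba \<union> Bb)" e]
        ellS[unfolded ell2_def] e0 by simp_all
    have "(\<Sum>\<^sub>\<infinity>w. (cmod (?A g w))\<^sup>2) \<le> (\<Sum>\<^sub>\<infinity>w. (cmod (branch_adjoint p m1 g w))\<^sup>2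
        + (cmod (branch_adjoint p m2 g w))\<^sup>2)"
      using ellA ellm pointwise unfolding ell2_def by (intro infsum_mono summable_on_add)
    also have "\<dots> = (\<Sum>\<^sub>\<infinity>w. (cmod (branch_adjoint p m1 g w))\<^sup>2) +
        (\<Sum>\<^sub>\<infinity>w. (cmod (branch_adjoint p m2 g w))\<^sup>2)"
      using ellm unfolding ell2_def by (rule infsum_add)
    also have "\<dots> = (\<Sum>\<^sub>\<infinity>x\<in>insert v Ba. (cmod (m1 x * g x))\<^sup>2) + (\<Sum>\<^sub>\<infinity>x\<in>Bb. (cmod (m2 x * g x))\<^sup>2)"
      by (simp only: branch_adjoint_sq_sum[OF inj1(1)] branch_adjoint_sq_sum[OF inj2(1)] supp1 supp2)
    also have "\<dots> = (\<Sum>\<^sub>\<infinity>x\<in>insert v Ba. e x) + (\<Sum>\<^sub>\<infinity>x\<in>Bb. e x)"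
    proof -
      have "(cmod (m1 x * g x))\<^sup>2 = e x" if "x \<in> insert v Ba" for x
        using that v_notin disj by (auto simp: e_def m2_def)
      moreover have "(cmod (m2 x * g x))\<^sup>2 = e x" if "x \<in> Bb" for x
        using that v_notin disj by (auto simp: e_def m1_def)
      ultimately show ?thesis by (intro arg_cong2[of _ _ _ _ "(+)"] infsum_cong)
    qed
    also have "\<dots> = (\<Sum>\<^sub>\<infinity>x\<in>insert v Ba \<union> Bb. e x)"
    proof (rule infsum_Un_disjoint[symmetric])
      show "e summable_on insert v Ba" "e summable_on Bb"
        by (rule summable_on_subset_banach[OF sum(1)]; blast)+
      show "insert v Ba \<inter> Bb = {}" using v_notin disj by blast
    qed
    also have "\<dots> \<le> (\<Sum>\<^sub>\<infinity>x. (cmod (wshift p lam g x))\<^sup>2)"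
      using sum(2) by simp
    finally show ?thesis by (simp add: l2norm_le_iff)
  qed
  have hyp: "hyponormal (wshift p lam)"
    unfolding hyponormal_iff using bdd adj le by blast
  have w: "weights p lam"
    unfolding weights_def roots_def
    using lam_supp v Ba_core Bb_core core_nonroot[of _ p] by blast

  have "\<not> hyponormal (wshift p lam ^^ 2)"
  proof
    let ?S2 = "wshift p lam ^^ 2"
    assume "hyponormal ?S2"
    then obtain A where A: "is_adjoint ?S2 A" "\<forall>f. ell2 f \<longrightarrow> l2norm (A f) \<le> l2norm (?S2 f)"
      unfolding hyponormal_iff by blast
    have S2: "?S2 f x = lam x * lam (p x) * f (p (p x))" for f x
      unfolding wshift_funpow by (simp add: numeral_2_eq_2)
    have psa: "p (s a) = a" "p (s (s a)) = s a" using s a by auto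
    have lam_sa: "lam (s a) = 1" "lam (s (s a)) = 1"
      using lam_Ba sa aBa by auto
    \<comment> \<open>\<open>S^2 e_a\<close> lives on grandchildren of \<open>a\<close> with nonzero
      weight. These have depth 3 below \<open>v\<close>, which excludes \<open>v\<close> and,
      through the ancestor just below \<open>v\<close>, the branch of \<open>b\<close>; on
      \<open>Ba\<close> only \<open>s (s a)\<close> remains.\<close>
    have "?S2 (unit_vec a) = unit_vec (s (s a))"
    proof
      fix x
      show "?S2 (unit_vec a) x = unit_vec (s (s a)) x"
      proof (cases "lam x \<noteq> 0 \<and> p (p x) = a")
        case True
        have d: "(p ^^ 3) x = v" using True a by (simp add: eval_nat_numeral)
        have "x \<noteq> v" using d depth[of 0 v 3] by auto
        moreover have "x \<notin> Bb"
        proof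
          assume "x \<in> Bb"
          then obtain k where k: "(p ^^ k) x = b" "(p ^^ Suc k) x = v" using BbE by blast
          then have "Suc k = 3" using depth d by blast
          then have "k = 2" by simp
          then show False using k True \<open>a \<noteq> b\<close> by (simp add: eval_nat_numeral)
        qed
        ultimately have "x \<in> Ba" using lam_supp True by blast
        then obtain k where k: "x = (s ^^ k) a" "(p ^^ Suc k) x = v" using BaE by blast
        then have "Suc k = 3" using depth d by blast
        then have "x = s (s a)" using k by (simp add: eval_nat_numeral)
        then show ?thesis by (simp add: S2 psa lam_sa unit_vec_def)
      next
        case False
        then have "x \<noteq> s (s a)" using psa lam_sa by auto
        then show ?thesis using False by (auto simp: S2 unit_vec_def)
      qed
    qed
    then have "l2norm (A (unit_vec a)) \<le> 1"
      using A(2)[rule_format, OF ell2_unit_vec[of a]] by (simp add: l2norm_unit_vec)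
    moreover have "cmod (A (unit_vec a) (p v)) \<le> l2norm (A (unit_vec a))"
      using A(1) by (intro cmod_le_l2norm) (simp add: is_adjoint_def ell2_unit_vec)
    \<comment> \<open>Since \<open>p (p a) = p v\<close>, this entry is the conjugate of
      \<open>lam a * lam v = 2/3 * 2\<close>.\<close>
    moreover have "A (unit_vec a) (p v) = 4 / 3"
      unfolding adjoint_unit_vec_apply[OF A(1)] S2 by (simp add: a lam_v lam_a unit_vec_def)
    ultimately show False by simp
  qed
  then show ?thesis using w hyp by blast
qed

section \<open>Equivalence of the four conditions\<close>

theorem theorem5p4:
  fixes p :: "'v \<Rightarrow> 'v"
  assumes "directed_forest p"
  shows "((\<forall>lam. weights p lam \<and> bounded_on_l2 (wshift p lam) \<and> hyponormal (wshift p lam)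
              \<longrightarrow> (\<forall>n::nat. n \<ge> 1 \<longrightarrow> hyponormal (wshift p lam ^^ n)))
          \<longleftrightarrow> (\<forall>lam. weights p lam \<and> bounded_on_l2 (wshift p lam) \<and> hyponormal (wshift p lam)
              \<longrightarrow> hyponormal (wshift p lam ^^ 2)))
       \<and> ((\<forall>lam. weights p lam \<and> bounded_on_l2 (wshift p lam) \<and> hyponormal (wshift p lam)
              \<longrightarrow> hyponormal (wshift p lam ^^ 2))
          \<longleftrightarrow> forkless (leafless_support p))
       \<and> (forkless (leafless_support p)
          \<longleftrightarrow> (\<forall>q. directed_forest q \<and> leafless q \<and> thinner q p \<longrightarrow> forkless q))"
    (is "(?a \<longleftrightarrow> ?b) \<and> (?b \<longleftrightarrow> ?c) \<and> (?c \<longleftrightarrow> ?d)")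
proof -
  have ab: ?b if a: ?a
  proof (intro allI impI)
    fix lam assume "weights p lam \<and> bounded_on_l2 (wshift p lam) \<and> hyponormal (wshift p lam)"
    then show "hyponormal (wshift p lam ^^ 2)"
      by (rule a[rule_format]) simp
  qed
  have bc: ?c if b: ?b
    unfolding forkless_leafless_support_iff[OF assms]
  proof
    fix v assume v: "v \<in> core p"
    \<comment> \<open>Every core vertex has a core child; a second one would be a fork and yield a
      shift contradicting (b).\<close>
    show "\<exists>!u. u \<in> core p \<and> p u = v"
    proof (rule ex_ex1I)
      show "\<exists>u. u \<in> core p \<and> p u = v" using core_child[OF v] by blast
      fix x y assume xy: "x \<in> core p \<and> p x = v" "y \<in> core p \<and> p y = v"
      show "x = y"
      proof (rule ccontr)
        assume "x \<noteq> y"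
        then obtain lam where "weights p lam" "hyponormal (wshift p lam)"
          "\<not> hyponormal (wshift p lam ^^ 2)"
          using fork_square_not_hyponormal[OF assms v, of x y] xy by blast
        then show False using b hyponormal_iff by blast
      qed
    qed
  qed
  have ca: ?a if c: ?c
  proof (intro allI impI)
    fix lam and n :: nat
    assume lam: "weights p lam \<and> bounded_on_l2 (wshift p lam) \<and> hyponormal (wshift p lam)"
      and "n \<ge> 1"
    then obtain m where "n = Suc m" by (cases n) auto
    moreover have "hyponormal (wshift p lam ^^ Suc m)"
    proof (rule hyponormal_funpow_wshift)
      fix x y assume "x \<in> core p" "y \<in> core p" "p x = p y" "p x \<in> core p"
      moreover from this have "\<exists>!u. u \<in> core p \<and> p u = p x"
        using c forkless_leafless_support_iff[OF assms] by blast
      ultimately show "x = y" by metis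
    qed (use lam in simp_all)
    ultimately show "hyponormal (wshift p lam ^^ n)" by simp
  qed
  have cd: "?c \<longleftrightarrow> ?d" by (rule forkless_support_iff_thinner_forkless[OF assms])
  from ab bc ca have "?a \<longleftrightarrow> ?b" "?b \<longleftrightarrow> ?c" by satx+
  with cd show ?thesis by (intro conjI)
qed

end
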